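(* Let $l\ge 1$ and $n>l$ be integers, let $t(X)=s(X)$ be an equation in $Eq(n)$, and let $Y=\mathrm{V}(t(X)=s(X))\subseteq L_l^n$ be its solution set over $L_l$. Then the number of $Y$-irreducible ordered partitions of $X$ is equal to the number of irreducible components of $Y$.
   Context: $L_l=\{a_1,\dots,a_l\}$ with $a_1<a_2<\dots<a_l$ is the linearly ordered semilattice of $l$ elements, with multiplication $a_i\cdot a_j=a_{\min(i,j)}$. A term in the variables $X=\{x_1,\dots,x_n\}$ is a (non-empty) commutative word in the letters $x_i$ (no constants); $\mathrm{Var}(t)$ is the set of variables occurring in $t$. An equation is an equality of terms $t(X)=s(X)$; an inequality $t(X)\le s(X)$ is also regarded as an equation, namely $t(X)s(X)=t(X)$. $Eq(n)$ is the set of equations $t(X)=s(X)$ such that every variable $x_1,\dots,x_n$ occurs in $t$ or in $s$. A point $P\in L_l^n$ is a solution of $t(X)=s(X)$ if $t(P)=s(P)$ in $L_l$. A system is an arbitrary set of equations, and $\mathrm{V}(\mathbf{S})\subseteq L_l^n$ is the set of common solutions of a system $\mathbf{S}$ in $n$ variables. A set $Y\subseteq L_l^n$ is algebraic over $L_l$ if $Y=\mathrm{V}(\mathbf S)$ for some system $\mathbf S$ in $n$ variables. An algebraic set is irreducible if it is not a proper finite union of other algebraic sets. Every algebraic set $Y$ has a unique (up to permutation) decomposition $Y=Y_1\cup\dots\cup Y_m$ into irreducible algebraic sets with $Y_i\nsubseteq Y_j$ for $i\ne j$; the $Y_i$ are the irreducible components of $Y$. An ordered partition of $X$ is a tuple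 $\sigma=(X_1,X_2,\dots,X_l)$ of $l$ pairwise disjoint non-empty sets with union $X$, the classes being linearly ordered by $X_1\le_\sigma X_2\le_\sigma\dots\le_\sigma X_l$. For $Y=\mathrm{V}(t(X)=s(X))$, the ordered partition $\sigma$ is $Y$-irreducible if the minimal class $X_1$ contains a variable from $\mathrm{Var}(t)$ and a variable from $\mathrm{Var}(s)$ (possibly the same variable). *)

theory Defs
  imports "HOL-Library.Multiset" "HOL-Library.FuncSet"
begin

text \<open>
  The element a_i of L_l is represented by the number i, so L_l is the set {1..l} with
  multiplication min; the variable x_i is represented by its index i, so X is {1..n}.
\<close>

definition L :: "nat \<Rightarrow> nat set" where
  "L l = {1..l}"

definition vars :: "nat \<Rightarrow> nat set" where
  "vars n = {1..n}"

text \<open>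
  Words in commuting letters are multisets of variables; an exponent larger than 1 is
  allowed, and the empty word is excluded.  An inequality t \<le> s is the equation
  (t + s, t), addition of multisets being concatenation of words.
\<close>

type_synonym word = "nat multiset"
type_synonym equation = "word \<times> word"

abbreviation Var :: "word \<Rightarrow> nat set" where
  "Var t \<equiv> set_mset t"

definition terms :: "nat \<Rightarrow> word set" where
  "terms n = {t. t \<noteq> {#} \<and> Var t \<subseteq> vars n}"

definition equations :: "nat \<Rightarrow> equation set" where
  "equations n = terms n \<times> terms n"

definition Eq :: "nat \<Rightarrow> equation set" where
  "Eq n = {(t, s) \<in> equations n. Var t \<union> Var s = vars n}"

definition points :: "nat \<Rightarrow> nat \<Rightarrow> (nat \<Rightarrow> nat) set" where
  "points l n = vars n \<rightarrow>\<^sub>E L l"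

text \<open>
  The product in L_l of the values of the letters.  The fold may start at a_l because
  a_l is the neutral element of L_l; by eval_single and eval_mult this is the usual
  evaluation on non-empty words.
\<close>

definition eval :: "nat \<Rightarrow> (nat \<Rightarrow> nat) \<Rightarrow> word \<Rightarrow> nat" where
  "eval l P t = fold_mset min l (image_mset P t)"

lemma eval_add_letter: "eval l P (add_mset i t) = min (P i) (eval l P t)"
proof -
  interpret comp_fun_commute "min :: nat \<Rightarrow> nat \<Rightarrow> nat"
    by standard (simp add: fun_eq_iff min.left_commute)
  show ?thesis by (simp add: eval_def)
qed

lemma eval_single:
  assumes "P \<in> points l n" and "i \<in> vars n"
  shows "eval l P {#i#} = P i"
proof -
  have "P i \<in> L l" using assms by (auto simp: points_def)
  then show ?thesis by (simp add: eval_add_letter) (simp add: eval_def L_def)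
qed

lemma eval_mult: "eval l P (t + s) = min (eval l P t) (eval l P s)"
proof -
  have le: "eval l P u \<le> l" for u
    by (induction u) (simp_all add: eval_add_letter min.coboundedI2, simp add: eval_def)
  show ?thesis
  proof (induction t)
    case empty
    then show ?case using le[of s] by (simp add: eval_def)
  next
    case (add i t)
    then show ?case by (simp add: eval_add_letter min.assoc)
  qed
qed

definition solution :: "nat \<Rightarrow> (nat \<Rightarrow> nat) \<Rightarrow> equation \<Rightarrow> bool" where
  "solution l P e \<longleftrightarrow> eval l P (fst e) = eval l P (snd e)"

definition V :: "nat \<Rightarrow> nat \<Rightarrow> equation set \<Rightarrow> (nat \<Rightarrow> nat) set" where
  "V l n S = {P \<in> points l n. \<forall>e\<in>S. solution l P e}"

definition algebraic :: "nat \<Rightarrow> nat \<Rightarrow> (nat \<Rightarrow> nat) set \<Rightarrow> bool" where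
  "algebraic l n Y \<longleftrightarrow> (\<exists>S \<subseteq> equations n. Y = V l n S)"

definition irreducible_set :: "nat \<Rightarrow> nat \<Rightarrow> (nat \<Rightarrow> nat) set \<Rightarrow> bool" where
  "irreducible_set l n Y \<longleftrightarrow> algebraic l n Y \<and>
     \<not> (\<exists>F. finite F \<and> (\<forall>Z\<in>F. algebraic l n Z \<and> Z \<noteq> Y) \<and> Y = \<Union>F)"

definition decomposition :: "nat \<Rightarrow> nat \<Rightarrow> (nat \<Rightarrow> nat) set \<Rightarrow> (nat \<Rightarrow> nat) set set \<Rightarrow> bool" where
  "decomposition l n Y F \<longleftrightarrow> finite F \<and> (\<forall>Z\<in>F. irreducible_set l n Z) \<and> Y = \<Union>F \<and>
     (\<forall>Z\<in>F. \<forall>Z'\<in>F. Z \<noteq> Z' \<longrightarrow> \<not> Z \<subseteq> Z')"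

text \<open>Every algebraic set has exactly one decomposition, so the description is proper.\<close>

definition irreducible_components ::
  "nat \<Rightarrow> nat \<Rightarrow> (nat \<Rightarrow> nat) set \<Rightarrow> (nat \<Rightarrow> nat) set set" where
  "irreducible_components l n Y = (THE F. decomposition l n Y F)"

text \<open>
  An ordered partition is the list of its classes in increasing order, hence the minimal
  class is the one at position 0.
\<close>

definition ordered_partition :: "nat \<Rightarrow> nat \<Rightarrow> nat set list \<Rightarrow> bool" where
  "ordered_partition l n \<sigma> \<longleftrightarrow> length \<sigma> = l \<and>
     (\<forall>i<l. \<sigma> ! i \<noteq> {}) \<and>
     (\<forall>i<l. \<forall>j<l. i \<noteq> j \<longrightarrow> \<sigma> ! i \<inter> \<sigma> ! j = {}) \<and>
     (\<Union>i<l. \<sigma> ! i) = vars n"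

text \<open>
  Irreducibility of an ordered partition with respect to the solution set of t = s refers
  to the two sides of the equation, which are therefore the parameters.
\<close>

definition irreducible_partition :: "word \<Rightarrow> word \<Rightarrow> nat set list \<Rightarrow> bool" where
  "irreducible_partition t s \<sigma> \<longleftrightarrow>
     (\<exists>x \<in> \<sigma> ! 0. x \<in> Var t) \<and> (\<exists>y \<in> \<sigma> ! 0. y \<in> Var s)"

end

theory Submission
  imports Defs
begin

text \<open>
  The smallest algebraic set containing a point P consists of the points that are monotone with
  respect to the preorder which P induces on the variables. These closures are irreducible, and
  every algebraic set is the finite union of the closures of its points, so the components of Y
  are the maximal closures of points of Y. A point attaining all l values has a maximal closure,
  from which it can be recovered. A point of Y attaining fewer than l values is never maximal:
  since n > l, one variable can be split off upwards from its class while a letter of t and a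
  letter of s stay in the minimal class. Hence the components correspond to the points of Y that
  attain all values, and these are the Y-irreducible ordered partitions.
\<close>

section \<open>Solutions as order conditions, and closures of points\<close>

definition point_closure :: "nat \<Rightarrow> nat \<Rightarrow> (nat \<Rightarrow> nat) \<Rightarrow> (nat \<Rightarrow> nat) set" where
  "point_closure l n P = V l n {e \<in> equations n. solution l P e}"

text \<open>The start value \<open>l\<close> of the fold never shows: the word is non-empty and
  every value of a point is at most \<open>l\<close>.\<close>

lemma eval_eq_Min:
  assumes "P \<in> points l n" "t \<in> terms n"
  shows "eval l P t = Min (P ` Var t)"
proof -
  have "Var t \<subseteq> vars n" "t \<noteq> {#}" using assms(2) by (auto simp: terms_def)
  then show ?thesis
  proof (induction t)
    case empty
    then show ?case by simp
  next
    case (add i t)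
    show ?case
    proof (cases "t = {#}")
      case True
      then show ?thesis using eval_single[OF assms(1), of i] add.prems by simp
    next
      case False
      then show ?thesis using add by (simp add: eval_add_letter)
    qed
  qed
qed

text \<open>Two minima agree exactly when the least value over both sides is attained on each side.
  In this form only comparisons between values of \<open>P\<close> occur, so the condition depends
  only on the preorder on the variables.\<close>

lemma solution_iff:
  assumes "P \<in> points l n" "(t, s) \<in> equations n"
  shows "solution l P (t, s) \<longleftrightarrow>
    (\<exists>a\<in>Var t. \<exists>b\<in>Var s. P a = P b \<and> (\<forall>x\<in>Var t \<union> Var s. P a \<le> P x))"
proof -
  have ts: "t \<in> terms n" "s \<in> terms n" using assms(2) by (auto simp: equations_def)
  then have ne: "P ` Var t \<noteq> {}" "P ` Var s \<noteq> {}" by (auto simp: terms_def)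
  have fin: "finite (P ` Var t)" "finite (P ` Var s)" by auto
  have sol: "solution l P (t, s) \<longleftrightarrow> Min (P ` Var t) = Min (P ` Var s)"
    by (simp add: solution_def eval_eq_Min[OF assms(1)] ts)
  show ?thesis
  proof
    assume "solution l P (t, s)"
    then have eq: "Min (P ` Var t) = Min (P ` Var s)" using sol by simp
    obtain a where a: "a \<in> Var t" "P a = Min (P ` Var t)" using Min_in[OF fin(1) ne(1)] by auto
    obtain b where b: "b \<in> Var s" "P b = Min (P ` Var s)" using Min_in[OF fin(2) ne(2)] by auto
    have "P a \<le> P x" if "x \<in> Var t \<union> Var s" for x
      using that a b eq Min_le[OF fin(1), of "P x"] Min_le[OF fin(2), of "P x"] by auto
    then show "\<exists>a\<in>Var t. \<exists>b\<in>Var s. P a = P b \<and> (\<forall>x\<in>Var t \<union> Var s. P a \<le> P x)"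
      using a b eq by (intro bexI[of _ a] bexI[of _ b]) auto
  next
    assume "\<exists>a\<in>Var t. \<exists>b\<in>Var s. P a = P b \<and> (\<forall>x\<in>Var t \<union> Var s. P a \<le> P x)"
    then obtain a b where ab: "a \<in> Var t" "b \<in> Var s" "P a = P b"
      "\<forall>x\<in>Var t \<union> Var s. P a \<le> P x" by blast
    have "Min (P ` Var t) = P a" using ab(1,4) by (intro Min_eqI) auto
    moreover have "Min (P ` Var s) = P b" using ab(2-4) by (intro Min_eqI) auto
    ultimately show "solution l P (t, s)" using sol ab(3) by simp
  qed
qed

text \<open>Each comparison \<open>P x \<le> P y\<close> is itself an equation satisfied by
  \<open>P\<close>, so points of the closure respect it. Conversely, a monotone \<open>Q\<close>
  keeps the witnesses \<open>a\<close> and \<open>b\<close> of any equation that holds at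
  \<open>P\<close>.\<close>

lemma point_closure_iff:
  assumes "P \<in> points l n"
  shows "Q \<in> point_closure l n P \<longleftrightarrow>
    Q \<in> points l n \<and> (\<forall>x\<in>vars n. \<forall>y\<in>vars n. P x \<le> P y \<longrightarrow> Q x \<le> Q y)"
proof safe
  assume "Q \<in> point_closure l n P"
  then show Q: "Q \<in> points l n" by (simp add: point_closure_def V_def)
  fix x y assume xy: "x \<in> vars n" "y \<in> vars n" "P x \<le> P y"
  \<comment> \<open>The equation x = xy expresses the inequality of x and y.\<close>
  have e: "({#x#}, {#x, y#}) \<in> equations n" using xy by (auto simp: equations_def terms_def)
  have "solution l P ({#x#}, {#x, y#})"
    unfolding solution_iff[OF assms e] using xy by auto
  then have "solution l Q ({#x#}, {#x, y#})"
    using \<open>Q \<in> point_closure l n P\<close> e by (auto simp: point_closure_def V_def)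
  then show "Q x \<le> Q y" unfolding solution_iff[OF Q e] by auto
next
  assume Q: "Q \<in> points l n" and
    mono: "\<forall>x\<in>vars n. \<forall>y\<in>vars n. P x \<le> P y \<longrightarrow> Q x \<le> Q y"
  have "solution l Q (t, s)" if e: "(t, s) \<in> equations n" and sol: "solution l P (t, s)" for t s
  proof -
    obtain a b where ab: "a \<in> Var t" "b \<in> Var s" "P a = P b"
      "\<forall>x\<in>Var t \<union> Var s. P a \<le> P x"
      using sol unfolding solution_iff[OF assms e] by blast
    have sub: "Var t \<union> Var s \<subseteq> vars n" using e by (auto simp: equations_def terms_def)
    have "a \<in> vars n" "b \<in> vars n" using ab sub by auto
    then have "Q a = Q b" using mono ab(3) by (intro antisym) auto
    moreover have "\<forall>x\<in>Var t \<union> Var s. Q a \<le> Q x"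
      using mono ab sub \<open>a \<in> vars n\<close> by blast
    ultimately show ?thesis unfolding solution_iff[OF Q e] using ab by blast
  qed
  then show "Q \<in> point_closure l n P" using Q by (auto simp: point_closure_def V_def)
qed

lemma algebraic_point_closure: "algebraic l n (point_closure l n P)"
  unfolding algebraic_def point_closure_def
  by (intro exI[of _ "{e \<in> equations n. solution l P e}"]) auto

lemma point_closure_subset:
  assumes "algebraic l n Z" "P \<in> Z"
  shows "point_closure l n P \<subseteq> Z"
  using assms by (auto simp: algebraic_def point_closure_def V_def)

lemma point_in_closure: "P \<in> points l n \<Longrightarrow> P \<in> point_closure l n P"
  by (simp add: point_closure_iff)

text \<open>In any cover by algebraic sets, the member that contains \<open>P\<close> already
  contains the whole closure.\<close>

lemma irreducible_point_closure:
  assumes "P \<in> points l n"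
  shows "irreducible_set l n (point_closure l n P)"
  unfolding irreducible_set_def
proof (intro conjI notI algebraic_point_closure)
  assume "\<exists>F. finite F \<and> (\<forall>Z\<in>F. algebraic l n Z \<and> Z \<noteq> point_closure l n P) \<and>
    point_closure l n P = \<Union>F"
  then obtain F where F: "\<forall>Z\<in>F. algebraic l n Z \<and> Z \<noteq> point_closure l n P"
    "point_closure l n P = \<Union>F" by (elim exE conjE)
  have "P \<in> \<Union>F" using point_in_closure[OF assms] unfolding F(2) .
  then obtain Z where Z: "Z \<in> F" "P \<in> Z" by (rule UnionE)
  have "point_closure l n P \<subseteq> Z"
    using bspec[OF F(1) Z(1)] Z(2) by (intro point_closure_subset) simp_all
  moreover have "Z \<subseteq> point_closure l n P" unfolding F(2) using Z(1) by (rule Union_upper)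
  ultimately have "Z = point_closure l n P" by (rule subset_antisym[rotated])
  then show False using bspec[OF F(1) Z(1)] by simp
qed

section \<open>Uniqueness of irreducible decompositions\<close>

lemma algebraic_Int:
  assumes "algebraic l n A" "algebraic l n B"
  shows "algebraic l n (A \<inter> B)"
proof -
  obtain S where "S \<subseteq> equations n" "A = V l n S"
    using assms(1) unfolding algebraic_def by blast
  moreover obtain T where "T \<subseteq> equations n" "B = V l n T"
    using assms(2) unfolding algebraic_def by blast
  moreover have "V l n S \<inter> V l n T = V l n (S \<union> T)" for S T
    unfolding V_def by (simp only: Ball_def Un_iff) blast
  ultimately show ?thesis unfolding algebraic_def by (metis Un_least)
qed

text \<open>If no single \<open>W\<close> contained \<open>Z\<close>, the traces of the sets
  \<open>W\<close> on \<open>Z\<close> would be a finite cover of \<open>Z\<close> by algebraic sets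
  different from \<open>Z\<close>.\<close>

lemma irreducible_subset_Union:
  assumes "irreducible_set l n Z" "finite F" "\<forall>W\<in>F. algebraic l n W" "Z \<subseteq> \<Union>F"
  obtains W where "W \<in> F" "Z \<subseteq> W"
proof -
  have "\<exists>W\<in>F. Z \<inter> W = Z"
  proof (rule ccontr)
    assume "\<not> (\<exists>W\<in>F. Z \<inter> W = Z)"
    then have "\<forall>W'\<in>(\<inter>) Z ` F. algebraic l n W' \<and> W' \<noteq> Z"
      using assms by (auto simp: irreducible_set_def intro: algebraic_Int)
    moreover have "finite ((\<inter>) Z ` F)" "Z = \<Union>((\<inter>) Z ` F)" using assms by auto
    ultimately show False using assms(1) unfolding irreducible_set_def by blast
  qed
  then show thesis using that by blast
qed

text \<open>A member of \<open>F\<close> lies in a member of \<open>G\<close>, which lies in a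
  member of \<open>F\<close>; incomparability within \<open>F\<close> makes all three equal.
  Exchanging \<open>F\<close> and \<open>G\<close> gives uniqueness.\<close>

lemma decomposition_subset:
  assumes "decomposition l n Y F" "decomposition l n Y G"
  shows "F \<subseteq> G"
proof
  fix Z assume Z: "Z \<in> F"
  have irr: "\<forall>W\<in>F \<union> G. irreducible_set l n W" and fin: "finite F" "finite G"
    and un: "\<Union>F = Y" "\<Union>G = Y"
    using assms by (auto simp: decomposition_def)
  have alg: "\<forall>W\<in>F \<union> G. algebraic l n W" using irr by (auto simp: irreducible_set_def)
  obtain W where W: "W \<in> G" "Z \<subseteq> W"
    using irreducible_subset_Union[of l n Z G] irr fin un alg Z by blast
  obtain Z' where Z': "Z' \<in> F" "W \<subseteq> Z'"
    using irreducible_subset_Union[of l n W F] irr fin un alg W by blast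
  have "Z = Z'" using assms(1) Z Z' W unfolding decomposition_def by blast
  then show "Z \<in> G" using W Z' by auto
qed

lemma irreducible_components_eq:
  assumes "decomposition l n Y F"
  shows "irreducible_components l n Y = F"
  unfolding irreducible_components_def
proof (rule the_equality)
  show "G = F" if "decomposition l n Y G" for G
    using decomposition_subset[OF assms that] decomposition_subset[OF that assms] by auto
qed (rule assms)

section \<open>Points attaining all values\<close>

lemma image_subset_L: "P \<in> points l n \<Longrightarrow> P ` vars n \<subseteq> L l"
  by (auto simp: points_def)

lemma finite_points: "finite (points l n)"
  unfolding points_def by (intro finite_PiE) (auto simp: vars_def L_def)

text \<open>Membership in the closure makes \<open>P\<close> factor through \<open>Q\<close> by a
  monotone map \<open>f\<close>. As \<open>P\<close> attains all values, \<open>f\<close> is a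
  monotone bijection of a finite chain, hence the identity.\<close>

lemma surjective_point_unique:
  assumes P: "P \<in> points l n" "P ` vars n = L l" and Q: "Q \<in> points l n"
    and mem: "P \<in> point_closure l n Q"
  shows "P = Q"
proof -
  \<comment> \<open>The chosen preimage does not matter: variables with equal
    \<open>Q\<close>-values have equal \<open>P\<close>-values.\<close>
  define f where "f v = P (inv_into (vars n) Q v)" for v
  have mono: "P x \<le> P y" if "x \<in> vars n" "y \<in> vars n" "Q x \<le> Q y" for x y
    using mem that unfolding point_closure_iff[OF Q] by blast
  have f: "f (Q x) = P x" if "x \<in> vars n" for x
    using that unfolding f_def
    by (intro antisym mono) (auto simp: inv_into_into f_inv_into_f)
  have img: "f ` Q ` vars n = L l" using f P(2) by (auto simp: image_image)
  have fin: "finite (Q ` vars n)" by (simp add: vars_def)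
  \<comment> \<open>Since \<open>f\<close> maps the values of \<open>Q\<close> onto
    \<open>L l\<close>, there are at least \<open>l\<close> of them.\<close>
  have "card (L l) \<le> card (Q ` vars n)" using card_image_le[OF fin, of f] img by simp
  moreover have "Q ` vars n \<subseteq> L l" by (rule image_subset_L[OF Q])
  ultimately have QL: "Q ` vars n = L l" by (intro card_seteq) (auto simp: L_def)
  then have inj: "inj_on f (L l)" using img by (intro eq_card_imp_inj_on) (auto simp: L_def)
  have fmono: "f v \<le> f w" if "v \<in> L l" "w \<in> L l" "v \<le> w" for v w
    using that mono f unfolding QL[symmetric] by auto
  have surj: "f ` L l = L l" using img QL by simp
  have fix_f: "f v = v" if v: "v \<in> L l" for v
  proof -
    have fv: "f v \<in> L l" using surj v by blast
    \<comment> \<open>A monotone bijection maps initial segments onto initial segments; comparing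
      their sizes yields \<open>f v = v\<close>.\<close>
    have "{1..f v} = f ` {1..v}"
    proof (intro subset_antisym subsetI)
      fix w assume w: "w \<in> {1..f v}"
      then have "w \<in> L l" using fv by (auto simp: L_def)
      then obtain u where u: "u \<in> L l" "w = f u" using surj by blast
      have "u \<le> v"
      proof (rule ccontr)
        assume "\<not> u \<le> v"
        then have "f v = f u" using fmono[OF v u(1)] w u(2) by auto
        then show False using inj_onD[OF inj _ v u(1)] \<open>\<not> u \<le> v\<close> by auto
      qed
      then show "w \<in> f ` {1..v}" using u by (auto simp: L_def)
    next
      fix w assume "w \<in> f ` {1..v}"
      then obtain u where u: "u \<in> L l" "u \<le> v" "w = f u" using v by (auto simp: L_def)
      then have "w \<in> L l" using surj by blast
      then show "w \<in> {1..f v}" using fmono[OF u(1) v u(2)] u by (auto simp: L_def)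
    qed
    moreover have "inj_on f {1..v}"
      using v by (intro inj_on_subset[OF inj]) (auto simp: L_def)
    ultimately have "card {1..f v} = card {1..v}" by (simp add: card_image)
    then show ?thesis by simp
  qed
  have "P x = Q x" if "x \<in> vars n" for x
  proof -
    have "Q x \<in> L l" using QL that by blast
    then show ?thesis using fix_f f[OF that] by simp
  qed
  then show ?thesis using PiE_ext[OF P(1)[unfolded points_def] Q[unfolded points_def]] by blast
qed

section \<open>Refining points that attain too few values\<close>

lemma exists_point_same_order:
  fixes g :: "nat \<Rightarrow> nat"
  assumes "card (g ` vars n) \<le> l"
  obtains P where "P \<in> points l n" "\<And>x y. x \<in> vars n \<Longrightarrow> y \<in> vars n \<Longrightarrow> P x \<le> P y \<longleftrightarrow> g x \<le> g y"
proof -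
  have fin: "finite (g ` vars n)" by (simp add: vars_def)
  \<comment> \<open>The rank of \<open>g x\<close> among the attained values. Each value counts
    itself, so ranks start at 1, and they do not exceed \<open>l\<close> by the bound on the number
    of values.\<close>
  define r where "r x = card {w \<in> g ` vars n. w \<le> g x}" for x
  have le: "r x \<le> r y" if "g x \<le> g y" for x y
    unfolding r_def using fin that by (intro card_mono) auto
  have less: "r y < r x" if "x \<in> vars n" "g y < g x" for x y
    unfolding r_def
  proof (intro psubset_card_mono psubsetI)
    have "g x \<in> {w \<in> g ` vars n. w \<le> g x}" "g x \<notin> {w \<in> g ` vars n. w \<le> g y}"
      using that by auto
    then show "{w \<in> g ` vars n. w \<le> g y} \<noteq> {w \<in> g ` vars n. w \<le> g x}" by blast
  qed (use fin that in auto)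
  have iff: "r x \<le> r y \<longleftrightarrow> g x \<le> g y" if "x \<in> vars n" for x y
    using le less[OF that] by (meson not_le)
  have "r x \<in> L l" if "x \<in> vars n" for x
  proof -
    have "r x \<le> card (g ` vars n)" unfolding r_def using fin by (intro card_mono) auto
    moreover have "r x > 0" unfolding r_def using fin that by (subst card_gt_0_iff) auto
    ultimately show ?thesis using assms by (simp add: L_def)
  qed
  then have "restrict r (vars n) \<in> points l n" by (auto simp: points_def)
  then show thesis by (rule that) (simp add: iff)
qed

text \<open>Equal preorders have the same classes, and the values of either function correspond to
  these classes.\<close>

lemma image_card_of_same_order:
  fixes P g :: "nat \<Rightarrow> nat"
  assumes "\<And>x y. x \<in> A \<Longrightarrow> y \<in> A \<Longrightarrow> P x \<le> P y \<longleftrightarrow> g x \<le> g y"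
  shows "card (P ` A) = card (g ` A)"
proof -
  have eq: "P x = P y \<longleftrightarrow> g x = g y" if "x \<in> A" "y \<in> A" for x y
    using assms[OF that] assms[OF that(2,1)] by (metis order.antisym order.refl)
  have "bij_betw (\<lambda>v. g (inv_into A P v)) (P ` A) (g ` A)"
  proof (rule bij_betwI')
    fix v w assume vw: "v \<in> P ` A" "w \<in> P ` A"
    then have "inv_into A P v \<in> A" "inv_into A P w \<in> A" by (auto intro: inv_into_into)
    then show "(g (inv_into A P v) = g (inv_into A P w)) = (v = w)"
      using eq[of "inv_into A P v" "inv_into A P w"] vw by (simp add: f_inv_into_f)
  next
    fix v assume "v \<in> P ` A"
    then show "g (inv_into A P v) \<in> g ` A" by (auto intro: inv_into_into)
  next
    fix u assume "u \<in> g ` A"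
    then obtain x where x: "x \<in> A" "u = g x" by auto
    have "inv_into A P (P x) \<in> A" "P (inv_into A P (P x)) = P x"
      using x by (auto intro: inv_into_into f_inv_into_f)
    then have "u = g (inv_into A P (P x))" using eq x by metis
    then show "\<exists>v\<in>P ` A. u = g (inv_into A P v)" using x by blast
  qed
  then show ?thesis by (rule bij_betw_same_card)
qed

lemma Eq_subset_equations: "Eq n \<subseteq> equations n"
  by (auto simp: Eq_def)

text \<open>Every variable occurs in the equation, so the common minimum is the global one:
  \<open>a\<close> and \<open>b\<close> lie in the minimal class of \<open>P\<close>, as in the
  definition of an irreducible partition.\<close>

lemma V_Eq_iff:
  assumes "(t, s) \<in> Eq n"
  shows "P \<in> V l n {(t, s)} \<longleftrightarrow> P \<in> points l n \<and>
    (\<exists>a\<in>Var t. \<exists>b\<in>Var s. P a = P b \<and> (\<forall>x\<in>vars n. P a \<le> P x))"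
proof -
  have "Var t \<union> Var s = vars n" using assms by (auto simp: Eq_def)
  moreover have "(t, s) \<in> equations n" using assms Eq_subset_equations by blast
  ultimately show ?thesis unfolding V_def using solution_iff[of P l n t s] by auto
qed

text \<open>A variable \<open>x\<close> other than \<open>a\<close> and \<open>b\<close> that shares
  its value with some \<open>x'\<close> is raised just above its class. The minimal class keeps
  \<open>a\<close> and \<open>b\<close>, so the equation still holds.\<close>

lemma split_class:
  assumes "n > l" "(t, s) \<in> Eq n" "Q \<in> V l n {(t, s)}" "card (Q ` vars n) < l"
  obtains P where "P \<in> V l n {(t, s)}" "Q \<in> point_closure l n P"
    "card (Q ` vars n) < card (P ` vars n)"
proof -
  obtain a b where Q: "Q \<in> points l n" and ab: "a \<in> Var t" "b \<in> Var s" "Q a = Q b"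
    "\<forall>x\<in>vars n. Q a \<le> Q x"
    using assms(3) unfolding V_Eq_iff[OF assms(2)] by blast
  have ab_vars: "a \<in> vars n" "b \<in> vars n" using ab assms(2) by (auto simp: Eq_def)
  have fin: "finite (vars n)" and card_vars: "card (vars n) = n" by (simp_all add: vars_def)
  \<comment> \<open>Pigeonhole: otherwise \<open>Q\<close> would be injective on a set of at least
    \<open>n - 1\<close> variables, but it attains fewer than \<open>l\<close> values and
    \<open>l \<le> n - 1\<close>.\<close>
  have "\<exists>x\<in>vars n - {a, b}. \<exists>x'\<in>vars n. x' \<noteq> x \<and> Q x' = Q x"
  proof (rule ccontr)
    assume no: "\<not> (\<exists>x\<in>vars n - {a, b}. \<exists>x'\<in>vars n. x' \<noteq> x \<and> Q x' = Q x)"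
    then have "inj_on Q (insert a (vars n - {a, b}))"
      using ab_vars unfolding inj_on_def by (metis DiffD1 insertE)
    then have "card (insert a (vars n - {a, b})) \<le> card (Q ` vars n)"
      using fin ab_vars by (intro card_inj_on_le[where f = Q]) auto
    \<comment> \<open>This inclusion treats \<open>a = b\<close> and \<open>a \<noteq> b\<close>
      alike.\<close>
    moreover have "vars n - {b} \<subseteq> insert a (vars n - {a, b})" by auto
    then have "card (vars n - {b}) \<le> card (insert a (vars n - {a, b}))"
      using fin by (intro card_mono) auto
    moreover have "card (vars n - {b}) = n - 1" using fin card_vars ab_vars by simp
    ultimately show False using assms by linarith
  qed
  then obtain x x' where x: "x \<in> vars n" "x \<noteq> a" "x \<noteq> b" "x' \<in> vars n" "x' \<noteq> x" "Q x' = Q x"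
    by blast
  \<comment> \<open>Doubling makes room for one odd value between the class of \<open>x\<close> and
    the next class.\<close>
  define g where "g y = 2 * Q y + (if y = x then 1 else 0)" for y
  have img: "g ` vars n = insert (2 * Q x + 1) ((*) 2 ` Q ` vars n)" (is "_ = insert _ ?B")
  proof (intro subset_antisym subsetI)
    fix w assume "w \<in> insert (2 * Q x + 1) ?B"
    then consider "w = g x" | y where "y \<in> vars n" "w = 2 * Q y" by (auto simp: g_def)
    then show "w \<in> g ` vars n"
    proof cases
      case 2
      \<comment> \<open>The old value of \<open>x\<close> remains attained at
        \<open>x'\<close>.\<close>
      then have "w = g (if y = x then x' else y)" using x by (auto simp: g_def)
      then show ?thesis using 2 x by auto
    qed (use x in auto)
  qed (auto simp: g_def)
  have "2 * Q x + 1 \<notin> ?B" by (auto, presburger)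
  moreover have "card ?B = card (Q ` vars n)" by (intro card_image) (auto simp: inj_on_def)
  ultimately have card_g: "card (g ` vars n) = Suc (card (Q ` vars n))"
    unfolding img using fin by simp
  then have "card (g ` vars n) \<le> l" using assms(4) by simp
  then obtain P where P: "P \<in> points l n"
    "\<And>y z. y \<in> vars n \<Longrightarrow> z \<in> vars n \<Longrightarrow> P y \<le> P z \<longleftrightarrow> g y \<le> g z"
    using exists_point_same_order by blast
  show thesis
  proof (rule that)
    have g_ab: "g a = g b" "\<forall>y\<in>vars n. g a \<le> g y" using ab x by (auto simp: g_def)
    then have "P a = P b" "\<forall>y\<in>vars n. P a \<le> P y" using P(2) ab_vars by (auto intro: antisym)
    then show "P \<in> V l n {(t, s)}" unfolding V_Eq_iff[OF assms(2)] using P(1) ab by blast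
    \<comment> \<open>The order of \<open>g\<close> only refines that of \<open>Q\<close>, as
      halving and rounding down recovers \<open>Q\<close>.\<close>
    have "Q y \<le> Q z" if "g y \<le> g z" for y z using that by (auto simp: g_def split: if_splits)
    then show "Q \<in> point_closure l n P" unfolding point_closure_iff[OF P(1)] using Q P(2) by blast
    show "card (Q ` vars n) < card (P ` vars n)"
      using card_g image_card_of_same_order[of "vars n" P g] P(2) by simp
  qed
qed

text \<open>Classes are split until no value is missing; the induction is on the number of missing
  values, and the closures grow along the way.\<close>

lemma exists_surjective_point:
  assumes "n > l" "(t, s) \<in> Eq n" "Q \<in> V l n {(t, s)}"
  shows "\<exists>P\<in>V l n {(t, s)}. P ` vars n = L l \<and> Q \<in> point_closure l n P"
  using assms(3)
proof (induction "l - card (Q ` vars n)" arbitrary: Q rule: less_induct)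
  case less
  have Q: "Q \<in> points l n" using less.prems by (simp add: V_def)
  show ?case
  proof (cases "card (Q ` vars n) < l")
    case True
    obtain P where P: "P \<in> V l n {(t, s)}" "Q \<in> point_closure l n P"
      "card (Q ` vars n) < card (P ` vars n)"
      using split_class[OF assms(1,2) less.prems True] .
    have "l - card (P ` vars n) < l - card (Q ` vars n)" using P(3) True by linarith
    then obtain R where R: "R \<in> V l n {(t, s)}" "R ` vars n = L l" "P \<in> point_closure l n R"
      using less.hyps P(1) by blast
    have "Q \<in> point_closure l n R"
      using point_closure_subset[OF algebraic_point_closure R(3)] P(2) by blast
    then show ?thesis using R by blast
  next
    case False
    then have "Q ` vars n = L l"
      using image_subset_L[OF Q] by (intro card_seteq) (auto simp: L_def)
    then show ?thesis using less.prems point_in_closure[OF Q] by blast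
  qed
qed

section \<open>The components of the solution set\<close>

definition surjective_solutions :: "nat \<Rightarrow> nat \<Rightarrow> equation \<Rightarrow> (nat \<Rightarrow> nat) set" where
  "surjective_solutions l n e = {P \<in> V l n {e}. P ` vars n = L l}"

lemma surjective_solutionsD:
  assumes "P \<in> surjective_solutions l n e"
  shows "P \<in> points l n" "P ` vars n = L l" "P \<in> V l n {e}"
  using assms by (simp_all add: surjective_solutions_def V_def)

lemma surjective_solutions_subset: "surjective_solutions l n e \<subseteq> points l n"
  by (rule subsetI) (rule surjective_solutionsD)

text \<open>Repeated splitting shows that the closures cover the solution set, and
  \<open>surjective_point_unique\<close> shows that no closure lies in a different one.\<close>

lemma decomposition_surjective_solutions:
  assumes "n > l" "(t, s) \<in> Eq n"
  shows "decomposition l n (V l n {(t, s)}) (point_closure l n ` surjective_solutions l n (t, s))"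
    (is "decomposition l n ?Y (_ ` ?S)")
proof -
  have "(t, s) \<in> equations n" using assms(2) Eq_subset_equations by blast
  then have alg: "algebraic l n ?Y"
    unfolding algebraic_def by (intro exI[of _ "{(t, s)}"]) simp
  have "\<Union> (point_closure l n ` ?S) \<subseteq> ?Y"
    using point_closure_subset[OF alg] by (auto simp: surjective_solutions_def)
  moreover have "?Y \<subseteq> \<Union> (point_closure l n ` ?S)"
    using exists_surjective_point[OF assms] by (fastforce simp: surjective_solutions_def)
  moreover have "finite ?S" using surjective_solutions_subset finite_points by (rule finite_subset)
  moreover have "P = Q" if "P \<in> ?S" "Q \<in> ?S" "point_closure l n P \<subseteq> point_closure l n Q" for P Q
  proof (rule surjective_point_unique)
    show "P \<in> point_closure l n Q"
      using that(3) point_in_closure[OF surjective_solutionsD(1)[OF that(1)]] by (rule subsetD)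
  qed (use that in \<open>simp_all add: surjective_solutionsD\<close>)
  ultimately show ?thesis
    unfolding decomposition_def
    by (auto simp: surjective_solutionsD intro: irreducible_point_closure)
qed

lemma inj_on_point_closure: "inj_on (point_closure l n) (surjective_solutions l n e)"
proof (rule inj_onI)
  fix P Q assume PQ: "P \<in> surjective_solutions l n e" "Q \<in> surjective_solutions l n e"
    "point_closure l n P = point_closure l n Q"
  then have "P \<in> point_closure l n Q"
    using point_in_closure[OF surjective_solutionsD(1)[OF PQ(1)]] by simp
  then show "P = Q"
    using surjective_solutionsD[OF PQ(1)] surjective_solutionsD[OF PQ(2)]
    by (intro surjective_point_unique)
qed

section \<open>Ordered partitions as level sets\<close>

definition level_sets :: "nat \<Rightarrow> nat \<Rightarrow> (nat \<Rightarrow> nat) \<Rightarrow> nat set list" where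
  "level_sets l n P = map (\<lambda>i. {x \<in> vars n. P x = Suc i}) [0..<l]"

lemma level_sets_nth: "i < l \<Longrightarrow> level_sets l n P ! i = {x \<in> vars n. P x = Suc i}"
  by (simp add: level_sets_def)

lemma ordered_partition_level_sets:
  assumes "P \<in> points l n" "P ` vars n = L l"
  shows "ordered_partition l n (level_sets l n P)"
proof -
  have "level_sets l n P ! i \<noteq> {}" if "i < l" for i
  proof -
    have "Suc i \<in> P ` vars n" using that assms(2) by (simp add: L_def)
    then show ?thesis using that by (auto simp: level_sets_nth)
  qed
  moreover have "\<exists>i<l. P x = Suc i" if "x \<in> vars n" for x
  proof -
    have "P x \<in> L l" using that assms(2) by blast
    \<comment> \<open>List positions start at 0 and values at 1.\<close>
    then show ?thesis by (intro exI[of _ "P x - 1"]) (auto simp: L_def)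
  qed
  then have "(\<Union>i<l. level_sets l n P ! i) = vars n" by (fastforce simp: level_sets_nth)
  ultimately show ?thesis
    unfolding ordered_partition_def by (auto simp: level_sets_nth) (simp add: level_sets_def)
qed

text \<open>The point sends each variable to the position of its class plus one; disjointness makes
  this position unique, and non-empty classes make every value attained.\<close>

lemma ordered_partition_eq_level_sets:
  assumes "ordered_partition l n \<sigma>"
  obtains P where "P \<in> points l n" "P ` vars n = L l" "\<sigma> = level_sets l n P"
proof -
  have len: "length \<sigma> = l" and ne: "\<And>i. i < l \<Longrightarrow> \<sigma> ! i \<noteq> {}"
    and disj: "\<And>i j. i < l \<Longrightarrow> j < l \<Longrightarrow> i \<noteq> j \<Longrightarrow> \<sigma> ! i \<inter> \<sigma> ! j = {}"
    and un: "(\<Union>i<l. \<sigma> ! i) = vars n"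
    using assms by (auto simp: ordered_partition_def)
  have "\<forall>x\<in>vars n. \<exists>i. i < l \<and> x \<in> \<sigma> ! i" using un by blast
  then obtain k where k: "\<And>x. x \<in> vars n \<Longrightarrow> k x < l \<and> x \<in> \<sigma> ! k x" by metis
  define P where "P = restrict (\<lambda>x. Suc (k x)) (vars n)"
  have sub: "\<sigma> ! i \<subseteq> vars n" if "i < l" for i using un that by blast
  have k_eq: "k x = i" if "i < l" "x \<in> \<sigma> ! i" for x i
    using disj[of "k x" i] k[of x] sub that by blast
  have level: "\<sigma> ! i = {x \<in> vars n. P x = Suc i}" if "i < l" for i
    using k k_eq[OF that] sub[OF that] by (auto simp: P_def)
  have P: "P \<in> points l n" using k by (auto simp: P_def points_def L_def Suc_le_eq)
  moreover have "L l \<subseteq> P ` vars n"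
  proof
    fix v assume "v \<in> L l"
    then have v: "v - 1 < l" "Suc (v - 1) = v" by (auto simp: L_def)
    then obtain x where "x \<in> \<sigma> ! (v - 1)" using ne by blast
    then show "v \<in> P ` vars n" using level[OF v(1)] v(2) by auto
  qed
  moreover have "\<sigma> = level_sets l n P"
    using len level by (intro nth_equalityI) (auto simp: level_sets_nth, simp add: level_sets_def)
  ultimately show thesis using that image_subset_L by blast
qed

lemma inj_on_level_sets: "inj_on (level_sets l n) (points l n)"
proof (rule inj_onI)
  fix P Q assume PQ: "P \<in> points l n" "Q \<in> points l n" "level_sets l n P = level_sets l n Q"
  have "P x = Q x" if x: "x \<in> vars n" for x
  proof -
    have "P x \<in> L l" using PQ(1) x by (auto simp: points_def)
    then have i: "P x - 1 < l" "Suc (P x - 1) = P x" by (auto simp: L_def)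
    then have "x \<in> level_sets l n P ! (P x - 1)" using x by (simp add: level_sets_nth)
    then show ?thesis unfolding PQ(3) using i by (simp add: level_sets_nth)
  qed
  then show "P = Q" using PiE_ext[OF PQ(1,2)[unfolded points_def]] by blast
qed

text \<open>The value 1 is attained, so the class at position 0 is where \<open>P\<close> is
  minimal, and both sides ask it to meet \<open>Var t\<close> and \<open>Var s\<close>.\<close>

lemma irreducible_partition_level_sets:
  assumes "l \<ge> 1" "(t, s) \<in> Eq n" "P \<in> points l n" "P ` vars n = L l"
  shows "irreducible_partition t s (level_sets l n P) \<longleftrightarrow> P \<in> V l n {(t, s)}"
proof -
  have vars: "Var t \<subseteq> vars n" "Var s \<subseteq> vars n" using assms(2) by (auto simp: Eq_def)
  have ge: "1 \<le> P x" if "x \<in> vars n" for x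
    using image_subset_L[OF assms(3)] that by (auto simp: L_def)
  have "1 \<in> P ` vars n" using assms(1,4) by (simp add: L_def)
  then obtain z where z: "z \<in> vars n" "P z = 1" by auto
  have "irreducible_partition t s (level_sets l n P) \<longleftrightarrow>
      (\<exists>a\<in>Var t. P a = 1) \<and> (\<exists>b\<in>Var s. P b = 1)"
    using assms(1) vars by (auto simp: irreducible_partition_def level_sets_nth)
  also have "\<dots> \<longleftrightarrow> (\<exists>a\<in>Var t. \<exists>b\<in>Var s. P a = P b \<and> (\<forall>x\<in>vars n. P a \<le> P x))"
  proof
    assume "(\<exists>a\<in>Var t. P a = 1) \<and> (\<exists>b\<in>Var s. P b = 1)"
    then obtain a b where "a \<in> Var t" "P a = 1" "b \<in> Var s" "P b = 1" by blast
    then show "\<exists>a\<in>Var t. \<exists>b\<in>Var s. P a = P b \<and> (\<forall>x\<in>vars n. P a \<le> P x)"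
      using ge by (intro bexI[of _ a] bexI[of _ b]) auto
  next
    assume "\<exists>a\<in>Var t. \<exists>b\<in>Var s. P a = P b \<and> (\<forall>x\<in>vars n. P a \<le> P x)"
    then obtain a b where ab: "a \<in> Var t" "b \<in> Var s" "P a = P b" "\<forall>x\<in>vars n. P a \<le> P x" by blast
    then have "P a = 1" using z ge vars by (metis le_antisym subsetD)
    then show "(\<exists>a\<in>Var t. P a = 1) \<and> (\<exists>b\<in>Var s. P b = 1)" using ab by metis
  qed
  finally show ?thesis unfolding V_Eq_iff[OF assms(2)] using assms(3) by simp
qed

lemma irreducible_partitions_eq_image:
  assumes "l \<ge> 1" "(t, s) \<in> Eq n"
  shows "{\<sigma>. ordered_partition l n \<sigma> \<and> irreducible_partition t s \<sigma>} =
    level_sets l n ` surjective_solutions l n (t, s)"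
proof (intro subset_antisym subsetI)
  fix \<sigma> assume "\<sigma> \<in> {\<sigma>. ordered_partition l n \<sigma> \<and> irreducible_partition t s \<sigma>}"
  then have \<sigma>: "ordered_partition l n \<sigma>" "irreducible_partition t s \<sigma>" by auto
  obtain P where P: "P \<in> points l n" "P ` vars n = L l" "\<sigma> = level_sets l n P"
    using ordered_partition_eq_level_sets[OF \<sigma>(1)] .
  then show "\<sigma> \<in> level_sets l n ` surjective_solutions l n (t, s)"
    using \<sigma>(2) irreducible_partition_level_sets[OF assms P(1,2)]
    by (auto simp: surjective_solutions_def)
next
  fix \<sigma> assume "\<sigma> \<in> level_sets l n ` surjective_solutions l n (t, s)"
  then obtain P where P: "\<sigma> = level_sets l n P" "P \<in> V l n {(t, s)}" "P ` vars n = L l"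
    by (auto simp: surjective_solutions_def)
  then have "P \<in> points l n" by (simp add: V_def)
  then show "\<sigma> \<in> {\<sigma>. ordered_partition l n \<sigma> \<and> irreducible_partition t s \<sigma>}"
    using P ordered_partition_level_sets irreducible_partition_level_sets[OF assms] by simp
qed

theorem theorem4p4:
  fixes l n :: nat and t s :: word and Y :: "(nat \<Rightarrow> nat) set"
  assumes "l \<ge> 1" and "n > l"
    and "(t, s) \<in> Eq n"
    and "Y = V l n {(t, s)}"
  shows "card {\<sigma>. ordered_partition l n \<sigma> \<and> irreducible_partition t s \<sigma>}
       = card (irreducible_components l n Y)"
proof -
  \<comment> \<open>The common index set: \<open>level_sets\<close> maps it injectively onto the
    partitions, \<open>point_closure\<close> onto the components.\<close>
  let ?S = "surjective_solutions l n (t, s)"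
  have "card {\<sigma>. ordered_partition l n \<sigma> \<and> irreducible_partition t s \<sigma>} = card ?S"
    unfolding irreducible_partitions_eq_image[OF assms(1,3)]
    using inj_on_subset[OF inj_on_level_sets surjective_solutions_subset] by (rule card_image)
  also have "\<dots> = card (point_closure l n ` ?S)"
    by (simp add: card_image inj_on_point_closure)
  also have "point_closure l n ` ?S = irreducible_components l n Y"
    unfolding assms(4)
    by (rule irreducible_components_eq[OF decomposition_surjective_solutions[OF assms(2,3)], symmetric])
  finally show ?thesis .
qed

end
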